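(* Let $f=(f_1,\ldots,f_m)\colon\mathbb{R}^n\to\mathbb{R}^m$ be a locally Lipschitz mapping and let $\Omega\subset\mathbb{R}^n$ be a nonempty closed set. The following assertions are equivalent: (i) The problem $\mathrm{Min}_{\mathbb{R}^m_+}\{f(x)\mid x\in\Omega\}$ admits a Pareto efficient solution. (ii) There exists a vector $\bar y\in f(\Omega)$ such that the section $[f(\Omega)]_{\bar y}$ is bounded and the inclusion $\widetilde K_{\infty,\leqq\bar y}(f,\Omega)\subset K_{0,\leqq\bar y}(f,\Omega)$ holds. (iii) There exists a vector $\bar y\in f(\Omega)$ such that the section $[f(\Omega)]_{\bar y}$ is bounded and the inclusion $K_{\infty,\leqq\bar y}(f,\Omega)\subset K_{0,\leqq\bar y}(f,\Omega)$ holds. (iv) There exists a vector $\bar y\in f(\Omega)$ such that the section $[f(\Omega)]_{\bar y}$ is bounded and the inclusion $T_{\infty,\leqq\bar y}(f,\Omega)\subset K_{0,\leqq\bar y}(f,\Omega)$ holds.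
   Context: $\mathbb{R}^n$ carries the usual scalar product $\langle\cdot,\cdot\rangle$ and Euclidean norm $\|\cdot\|$. $\mathbb{R}^m_+$ is the set of vectors in $\mathbb{R}^m$ with all components $\ge 0$. For $a,b\in\mathbb{R}^m$, $a\leqq b$ means $b-a\in\mathbb{R}^m_+$. Pareto efficiency: $\bar x\in\Omega$ is a Pareto efficient solution to $\mathrm{Min}_{\mathbb{R}^m_+}\{f(x)\mid x\in\Omega\}$ if there is no $x\in\Omega$ with $f(x)\leqq f(\bar x)$ and $f(x)\ne f(\bar x)$. Section: for $A\subset\mathbb{R}^m$ and $y\in\mathbb{R}^m$, $[A]_y:=A\cap(y-\mathbb{R}^m_+)$ is the section of $A$ at $y$. It is bounded if there is $a\in\mathbb{R}^m$ with $[A]_y\subset a+\mathbb{R}^m_+$. Normal cones and subdifferential: for $\Omega\subset\mathbb{R}^n$ and $\bar x\in\Omega$, the regular normal cone $\widehat N(\bar x;\Omega)$ consists of all $v\in\mathbb{R}^n$ with $\langle v,x-\bar x\rangle\le o(\|x-\bar x\|)$ as $x\to\bar x$, $x\in\Omega$. The limiting normal cone $N(\bar x;\Omega)$ consists of all $v$ for which there are sequences $x^k\to\bar x$ with $x^k\in\Omega$ and $v^k\to v$ with $v^k\in\widehat N(x^k;\Omega)$. For $\phi\colon\mathbb{R}^n\to\mathbb{R}$, the limiting subdifferential is $\partial\phi(\bar x):=\{v\in\mathbb{R}^n \mid (v,-1)\in N((\bar x,\phi(\bar x));\mathrm{epi}\,\phi)\}$, where $\mathrm{epi}\,\phi=\{(x,y)\in\mathbb{R}^n\times\mathbb{R}\mid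 \phi(x)\le y\}$. Rabier function: $$\nu(x):=\inf\Big\{\Big\|\sum_{i=1}^m\lambda_i v^i+w\Big\| \;\Big|\; v^i\in\partial f_i(x)\cup\partial(-f_i)(x),\ w\in N(x;\Omega),\ \lambda\in\mathbb{R}^m_+,\ \sum_{i=1}^m\lambda_i=1\Big\}.$$ The set $\Gamma(f,\Omega)$ consists of all $x\in\Omega$ for which there exist $v^i\in\partial f_i(x)\cup\partial(-f_i)(x)$, $i=1,\ldots,m$, and $(\lambda,\mu)\in\mathbb{R}^m_+\times\mathbb{R}$ with $\sum_{i=1}^m\lambda_i+|\mu|=1$ such that $0\in\sum_{i=1}^m\lambda_i v^i+\mu x+N(x;\Omega)$. For $\bar y\in\mathbb{R}^m$: - $\widetilde K_{\infty,\leqq\bar y}(f,\Omega)$ is the set of $y\in\mathbb{R}^m$ for which there is a sequence $\{x^k\}\subset\Omega$ with $f(x^k)\leqq\bar y$ for all $k$, $\|x^k\|\to\infty$, $f(x^k)\to y$, and $\nu(x^k)\to 0$. - $K_{\infty,\leqq\bar y}(f,\Omega)$ is the set of $y\in\mathbb{R}^m$ for which there is a sequence $\{x^k\}\subset\Omega$ with $f(x^k)\leqq\bar y$ for all $k$, $\|x^k\|\to\infty$, $f(x^k)\to y$, and $\|x^k\|\nu(x^k)\to 0$. - $T_{\infty,\leqq\bar y}(f,\Omega)$ is the set of $y\in\mathbb{R}^m$ for which there is a sequence $\{x^k\}\subset\Gamma(f,\Omega)$ with $f(x^k)\leqq\bar y$ for all $k$, $\|x^k\|\to\infty$, and $f(x^k)\to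 y$. - $K_{0,\leqq\bar y}(f,\Omega):=\{f(x)\mid x\in\Omega,\ f(x)\leqq\bar y,\ \nu(x)=0\}$. *)

theory Defs
  imports "HOL-Analysis.Analysis" "HOL-Library.Landau_Symbols"
begin

text \<open>
  On \<open>real ^ 'm\<close> the library order \<open>\<le>\<close> is the componentwise one, i.e. the order
  induced by the nonnegative orthant.
\<close>

definition nonneg_orthant :: "(real ^ 'm) set" where
  "nonneg_orthant = {y. \<forall>i. 0 \<le> y $ i}"

definition locally_lipschitz :: "('a::metric_space \<Rightarrow> 'b::metric_space) \<Rightarrow> bool" where
  "locally_lipschitz f \<longleftrightarrow> (\<forall>x. \<exists>U. open U \<and> x \<in> U \<and> (\<exists>L. L-lipschitz_on U f))"

definition pareto_efficient :: "('a \<Rightarrow> real ^ 'm) \<Rightarrow> 'a set \<Rightarrow> 'a \<Rightarrow> bool" where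
  "pareto_efficient f \<Omega> xbar \<longleftrightarrow>
     xbar \<in> \<Omega> \<and> \<not> (\<exists>x\<in>\<Omega>. f x \<le> f xbar \<and> f x \<noteq> f xbar)"

definition lower_section :: "(real ^ 'm) set \<Rightarrow> real ^ 'm \<Rightarrow> (real ^ 'm) set" where
  "lower_section A y = A \<inter> (\<lambda>z. y - z) ` nonneg_orthant"

text \<open>Only boundedness from below is required.\<close>

definition bounded_section :: "(real ^ 'm) set \<Rightarrow> real ^ 'm \<Rightarrow> bool" where
  "bounded_section A y \<longleftrightarrow> (\<exists>a. lower_section A y \<subseteq> (\<lambda>z. a + z) ` nonneg_orthant)"

text \<open>The two normal cones are meant for base points in \<open>\<Omega>\<close>, and are only used there.\<close>

definition regular_normal_cone :: "'a::real_inner \<Rightarrow> 'a set \<Rightarrow> 'a set" where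
  "regular_normal_cone xbar \<Omega> =
     {v. \<exists>r \<in> o[at xbar within \<Omega>](\<lambda>x. norm (x - xbar)).
           \<forall>\<^sub>F x in at xbar within \<Omega>. v \<bullet> (x - xbar) \<le> r x}"

definition limiting_normal_cone :: "'a::real_inner \<Rightarrow> 'a set \<Rightarrow> 'a set" where
  "limiting_normal_cone xbar \<Omega> =
     {v. \<exists>xs vs. (\<forall>k::nat. xs k \<in> \<Omega>) \<and> xs \<longlonglongrightarrow> xbar \<and>
           (\<forall>k. vs k \<in> regular_normal_cone (xs k) \<Omega>) \<and> vs \<longlonglongrightarrow> v}"

definition epi :: "('a \<Rightarrow> real) \<Rightarrow> ('a \<times> real) set" where
  "epi \<phi> = {(x, y). \<phi> x \<le> y}"

definition limiting_subdiff :: "('a::real_inner \<Rightarrow> real) \<Rightarrow> 'a \<Rightarrow> 'a set" where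
  "limiting_subdiff \<phi> xbar = {v. (v, -1) \<in> limiting_normal_cone (xbar, \<phi> xbar) (epi \<phi>)}"

definition symmetric_subdiff :: "('a::real_inner \<Rightarrow> real) \<Rightarrow> 'a \<Rightarrow> 'a set" where
  "symmetric_subdiff \<phi> x = limiting_subdiff \<phi> x \<union> limiting_subdiff (\<lambda>z. - \<phi> z) x"

text \<open>
  For locally Lipschitz \<open>f\<close> the subdifferentials are nonempty, and \<open>0\<close> is a normal at every
  point of \<open>\<Omega>\<close>; so the real-valued infimum below is never taken over the empty set for
  \<open>x \<in> \<Omega>\<close>.
\<close>

definition rabier :: "('a::real_inner \<Rightarrow> real ^ 'm) \<Rightarrow> 'a set \<Rightarrow> 'a \<Rightarrow> real" where
  "rabier f \<Omega> x =
     Inf {norm ((\<Sum>i\<in>UNIV. l $ i *\<^sub>R v i) + w) | (v :: 'm \<Rightarrow> 'a) w (l :: real ^ 'm).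
            (\<forall>i. v i \<in> symmetric_subdiff (\<lambda>z. f z $ i) x) \<and>
            w \<in> limiting_normal_cone x \<Omega> \<and>
            l \<in> nonneg_orthant \<and> (\<Sum>i\<in>UNIV. l $ i) = 1}"

definition Gamma_set :: "('a::real_inner \<Rightarrow> real ^ 'm) \<Rightarrow> 'a set \<Rightarrow> 'a set" where
  "Gamma_set f \<Omega> =
     {x \<in> \<Omega>. \<exists>(v :: 'm \<Rightarrow> 'a) (l :: real ^ 'm) (\<mu> :: real).
        (\<forall>i. v i \<in> symmetric_subdiff (\<lambda>z. f z $ i) x) \<and>
        l \<in> nonneg_orthant \<and> (\<Sum>i\<in>UNIV. l $ i) + \<bar>\<mu>\<bar> = 1 \<and>
        (\<exists>w \<in> limiting_normal_cone x \<Omega>. 0 = (\<Sum>i\<in>UNIV. l $ i *\<^sub>R v i) + \<mu> *\<^sub>R x + w)}"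

definition Ktilde_inf :: "('a::real_inner \<Rightarrow> real ^ 'm) \<Rightarrow> 'a set \<Rightarrow> real ^ 'm \<Rightarrow> (real ^ 'm) set" where
  "Ktilde_inf f \<Omega> ybar =
     {y. \<exists>xs :: nat \<Rightarrow> 'a. (\<forall>k. xs k \<in> \<Omega>) \<and> (\<forall>k. f (xs k) \<le> ybar) \<and>
           filterlim (\<lambda>k. norm (xs k)) at_top sequentially \<and>
           (\<lambda>k. f (xs k)) \<longlonglongrightarrow> y \<and>
           (\<lambda>k. rabier f \<Omega> (xs k)) \<longlonglongrightarrow> 0}"

definition K_inf :: "('a::real_inner \<Rightarrow> real ^ 'm) \<Rightarrow> 'a set \<Rightarrow> real ^ 'm \<Rightarrow> (real ^ 'm) set" where
  "K_inf f \<Omega> ybar =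
     {y. \<exists>xs :: nat \<Rightarrow> 'a. (\<forall>k. xs k \<in> \<Omega>) \<and> (\<forall>k. f (xs k) \<le> ybar) \<and>
           filterlim (\<lambda>k. norm (xs k)) at_top sequentially \<and>
           (\<lambda>k. f (xs k)) \<longlonglongrightarrow> y \<and>
           (\<lambda>k. norm (xs k) * rabier f \<Omega> (xs k)) \<longlonglongrightarrow> 0}"

definition T_inf :: "('a::real_inner \<Rightarrow> real ^ 'm) \<Rightarrow> 'a set \<Rightarrow> real ^ 'm \<Rightarrow> (real ^ 'm) set" where
  "T_inf f \<Omega> ybar =
     {y. \<exists>xs :: nat \<Rightarrow> 'a. (\<forall>k. xs k \<in> Gamma_set f \<Omega>) \<and> (\<forall>k. f (xs k) \<le> ybar) \<and>
           filterlim (\<lambda>k. norm (xs k)) at_top sequentially \<and>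
           (\<lambda>k. f (xs k)) \<longlonglongrightarrow> y}"

definition K_zero :: "('a::real_inner \<Rightarrow> real ^ 'm) \<Rightarrow> 'a set \<Rightarrow> real ^ 'm \<Rightarrow> (real ^ 'm) set" where
  "K_zero f \<Omega> ybar = {f x | x. x \<in> \<Omega> \<and> f x \<le> ybar \<and> rabier f \<Omega> x = 0}"

end

theory Submission
  imports Defs
begin

text \<open>
  A point is Pareto efficient as soon as it minimizes \<open>\<Sum>i. f\<^sub>i\<close> over \<open>S = {x \<in> \<Omega>. f x \<le> ybar}\<close> for some
  \<open>ybar\<close>, and conversely an efficient point does so for \<open>ybar = f xbar\<close>. Minimizers of
  \<open>\<Sum>i. f\<^sub>i + h\<close> over \<open>S \<inter> {e = 0}\<close> satisfy a multiplier rule. If the section is bounded and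
  \<open>\<Sum>i. f\<^sub>i\<close> has no minimizer on \<open>S\<close>, then two minimizing sequences escaping to infinity produce
  asymptotic values outside \<open>f ` S\<close>: minimizers of \<open>\<Sum>i. f\<^sub>i + \<epsilon> ln (1 + \<parallel>x\<parallel>\<^sup>2)\<close>, for which the rule gives
  \<open>\<parallel>x\<parallel> \<nu>(x) \<le> 2\<epsilon>\<close>, and minimizers of \<open>\<Sum>i. f\<^sub>i\<close> over spheres, which lie in \<open>\<Gamma>(f, \<Omega>)\<close>.
\<close>

section \<open>Regular normals and normals to epigraphs of Lipschitz functions\<close>

lemma regular_normal_cone_iff:
  fixes x :: "'a::real_inner"
  shows "v \<in> regular_normal_cone x S \<longleftrightarrow>
    (\<forall>c>0. \<forall>\<^sub>F y in at x within S. v \<bullet> (y - x) \<le> c * norm (y - x))"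
proof
  assume "v \<in> regular_normal_cone x S"
  then obtain r where r: "r \<in> o[at x within S](\<lambda>y. norm (y - x))"
    and le: "\<forall>\<^sub>F y in at x within S. v \<bullet> (y - x) \<le> r y"
    by (auto simp: regular_normal_cone_def)
  show "\<forall>c>0. \<forall>\<^sub>F y in at x within S. v \<bullet> (y - x) \<le> c * norm (y - x)"
  proof (intro allI impI)
    fix c :: real
    assume "c > 0"
    from landau_o.smallD[OF r this] le
    show "\<forall>\<^sub>F y in at x within S. v \<bullet> (y - x) \<le> c * norm (y - x)"
      by eventually_elim auto
  qed
next
  assume *: "\<forall>c>0. \<forall>\<^sub>F y in at x within S. v \<bullet> (y - x) \<le> c * norm (y - x)"
  \<comment> \<open>The positive part is the smallest nonnegative remainder that can work; being
    nonnegative, it is bounded in absolute value by the one-sided estimate.\<close>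
  have "(\<lambda>y. max 0 (v \<bullet> (y - x))) \<in> o[at x within S](\<lambda>y. norm (y - x))"
  proof (rule landau_o.smallI)
    fix c :: real
    assume "c > 0"
    with * have "\<forall>\<^sub>F y in at x within S. v \<bullet> (y - x) \<le> c * norm (y - x)" by blast
    then show "\<forall>\<^sub>F y in at x within S. norm (max 0 (v \<bullet> (y - x))) \<le> c * norm (norm (y - x))"
      by eventually_elim (use \<open>c > 0\<close> in auto)
  qed
  then show "v \<in> regular_normal_cone x S"
    unfolding regular_normal_cone_def
    by (intro CollectI bexI[of _ "\<lambda>y. max 0 (v \<bullet> (y - x))"] always_eventually) simp_all
qed

lemma regular_normal_cone_scaleR:
  assumes v: "v \<in> regular_normal_cone x S" and a: "0 \<le> a"
  shows "a *\<^sub>R v \<in> regular_normal_cone x S"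
proof (cases "a = 0")
  case True
  then show ?thesis
    by (auto simp: regular_normal_cone_iff intro!: always_eventually)
next
  case False
  with a have a: "a > 0" by simp
  show ?thesis
    unfolding regular_normal_cone_iff
  proof (intro allI impI)
    fix c :: real
    assume "c > 0"
    with a have "c / a > 0" by simp
    with v have "\<forall>\<^sub>F y in at x within S. v \<bullet> (y - x) \<le> c / a * norm (y - x)"
      unfolding regular_normal_cone_iff by blast
    then show "\<forall>\<^sub>F y in at x within S. (a *\<^sub>R v) \<bullet> (y - x) \<le> c * norm (y - x)"
      by eventually_elim (use a in \<open>simp add: field_simps\<close>)
  qed
qed

text \<open>Fermat's rule relative to a set: minimality gives \<open>0 \<le> F y - F x\<close>,
  which is \<open>G \<bullet> (y - x)\<close> up to a small remainder. All normals in the multiplier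
  rule arise this way.\<close>

lemma neg_gradient_regular_normal:
  assumes der: "(F has_derivative (\<lambda>d. G \<bullet> d)) (at x within S)"
    and min: "\<forall>\<^sub>F y in at x within S. F x \<le> F y"
  shows "- G \<in> regular_normal_cone x S"
  unfolding regular_normal_cone_iff
proof (intro allI impI)
  fix c :: real
  assume c: "c > 0"
  have "((\<lambda>y. norm (F y - F x - G \<bullet> (y - x)) / norm (y - x)) \<longlongrightarrow> 0) (at x within S)"
    using der by (simp add: has_derivative_iff_norm)
  from order_tendstoD(2)[OF this c] min
  show "\<forall>\<^sub>F y in at x within S. (- G) \<bullet> (y - x) \<le> c * norm (y - x)"
  proof eventually_elim
    case (elim y)
    show ?case
    proof (cases "y = x")
      case False
      then have "norm (F y - F x - G \<bullet> (y - x)) < c * norm (y - x)"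
        using elim(1) by (simp add: field_simps)
      with elim(2) show ?thesis by (simp add: abs_less_iff)
    qed simp
  qed
qed

lemma limiting_normal_coneI:
  fixes x :: "'a::real_inner"
  assumes "\<forall>\<^sub>F k in sequentially. xs k \<in> S"
    and "\<forall>\<^sub>F k in sequentially. vs k \<in> regular_normal_cone (xs k) S"
    and "xs \<longlonglongrightarrow> x" "vs \<longlonglongrightarrow> v"
  shows "v \<in> limiting_normal_cone x S"
proof -
  obtain N where N: "\<And>k. k \<ge> N \<Longrightarrow> xs k \<in> S \<and> vs k \<in> regular_normal_cone (xs k) S"
    using eventually_conj[OF assms(1,2)] unfolding eventually_sequentially by blast
  show ?thesis
    unfolding limiting_normal_cone_def
    using N assms(3,4)
    by (intro CollectI exI[of _ "\<lambda>k. xs (k + N)"] exI[of _ "\<lambda>k. vs (k + N)"])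
      (simp add: LIMSEQ_ignore_initial_segment)
qed

text \<open>Test the normal along the curve \<open>(x + t v, \<phi> (x + t v))\<close> on the graph:
  its first component contributes \<open>t * (v \<bullet> v)\<close>, while the Lipschitz bound
  limits the rest to order \<open>t * norm v\<close>. Dividing by \<open>t * norm v\<close> and
  letting \<open>c\<close> tend to 0 gives the bound. It provides the compactness from which
  limiting subgradients are extracted.\<close>

lemma regular_normal_epi_bound:
  fixes \<phi> :: "'a::real_inner \<Rightarrow> real"
  assumes lip: "L-lipschitz_on U \<phi>" and U: "open U" "x \<in> U"
    and v: "(v, -1) \<in> regular_normal_cone (x, \<phi> x) (epi \<phi>)"
  shows "norm v \<le> L"
proof (cases "v = 0")
  case True
  then show ?thesis using lipschitz_on_nonneg[OF lip] by simp
next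
  case False
  have L: "L \<ge> 0" using lipschitz_on_nonneg[OF lip] .
  have bound: "norm v \<le> L + c * (1 + L)" if c: "c > 0" for c
  proof -
    have tend0: "((\<lambda>t. x + t *\<^sub>R v) \<longlongrightarrow> x + 0 *\<^sub>R v) (at_right 0)"
      by (intro tendsto_intros)
    then have tend: "((\<lambda>t. x + t *\<^sub>R v) \<longlongrightarrow> x) (at_right 0)" by simp
    have inU: "\<forall>\<^sub>F t in at_right 0. x + t *\<^sub>R v \<in> U"
      using topological_tendstoD[OF tend U] .
    have "isCont \<phi> x"
      using lipschitz_on_continuous_on[OF lip] U continuous_on_eq_continuous_at by blast
    from isCont_tendsto_compose[OF this tend]
    have "((\<lambda>t. (x + t *\<^sub>R v, \<phi> (x + t *\<^sub>R v))) \<longlongrightarrow> (x, \<phi> x)) (at_right 0)"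
      using tend by (intro tendsto_Pair)
    moreover have "\<forall>\<^sub>F t in at_right (0::real). 0 < t"
      by (simp add: eventually_at_filter)
    then have "\<forall>\<^sub>F t in at_right 0. (x + t *\<^sub>R v, \<phi> (x + t *\<^sub>R v)) \<in> epi \<phi> \<and>
        (x + t *\<^sub>R v, \<phi> (x + t *\<^sub>R v)) \<noteq> (x, \<phi> x)"
      by eventually_elim (use False in \<open>auto simp: epi_def\<close>)
    ultimately have fl: "filterlim (\<lambda>t. (x + t *\<^sub>R v, \<phi> (x + t *\<^sub>R v))) (at (x, \<phi> x) within epi \<phi>) (at_right 0)"
      by (simp add: filterlim_at)
    from v c have "\<forall>\<^sub>F z in at (x, \<phi> x) within epi \<phi>.
        (v, -1) \<bullet> (z - (x, \<phi> x)) \<le> c * norm (z - (x, \<phi> x))"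
      unfolding regular_normal_cone_iff by blast
    from eventually_compose_filterlim[OF this fl] inU
    have "\<forall>\<^sub>F t in at_right 0. x + t *\<^sub>R v \<in> U \<and> 0 < t \<and>
        t * (v \<bullet> v) - (\<phi> (x + t *\<^sub>R v) - \<phi> x) \<le> c * norm (t *\<^sub>R v, \<phi> (x + t *\<^sub>R v) - \<phi> x)"
      using \<open>\<forall>\<^sub>F t in at_right (0::real). 0 < t\<close>
      by eventually_elim simp
    from eventually_happens[OF this] obtain t where t: "x + t *\<^sub>R v \<in> U" "0 < t"
      "t * (v \<bullet> v) - (\<phi> (x + t *\<^sub>R v) - \<phi> x) \<le> c * norm (t *\<^sub>R v, \<phi> (x + t *\<^sub>R v) - \<phi> x)"
      by auto
    have d: "\<bar>\<phi> (x + t *\<^sub>R v) - \<phi> x\<bar> \<le> L * (t * norm v)"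
      using lipschitz_onD[OF lip t(1) U(2)] t(2) by (simp add: dist_norm)
    have "norm (t *\<^sub>R v, \<phi> (x + t *\<^sub>R v) - \<phi> x) \<le> t * norm v + \<bar>\<phi> (x + t *\<^sub>R v) - \<phi> x\<bar>"
      using norm_Pair_le[of "t *\<^sub>R v" "\<phi> (x + t *\<^sub>R v) - \<phi> x"] t(2) by simp
    with d have "norm (t *\<^sub>R v, \<phi> (x + t *\<^sub>R v) - \<phi> x) \<le> (t * norm v) * (1 + L)"
      by (simp add: algebra_simps)
    then have "c * norm (t *\<^sub>R v, \<phi> (x + t *\<^sub>R v) - \<phi> x) \<le> c * ((t * norm v) * (1 + L))"
      using c by simp
    with t(3) d have "t * (v \<bullet> v) \<le> L * (t * norm v) + c * ((t * norm v) * (1 + L))"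
      by (simp add: abs_le_iff)
    then have "(t * norm v) * norm v \<le> (t * norm v) * (L + c * (1 + L))"
      by (simp add: power2_norm_eq_inner[symmetric] power2_eq_square algebra_simps)
    with t(2) False show ?thesis by simp
  qed
  show ?thesis
  proof (rule field_le_epsilon)
    fix e :: real
    assume "e > 0"
    with bound[of "e / (1 + L)"] L show "norm v \<le> L + e" by simp
  qed
qed

section \<open>Convergence of the penalty method and auxiliary estimates\<close>

text \<open>At a cluster point the penalty vanishes, because \<open>A\<close> is bounded below on
  \<open>K\<close> while the weights grow, and \<open>A\<close> stays at most \<open>C\<close>,
  because penalties are nonnegative. The uniqueness hypothesis then identifies the cluster
  point.\<close>

lemma penalty_method_converges:
  fixes A B :: "'a::metric_space \<Rightarrow> real"
  assumes K: "compact K" and cA: "continuous_on K A" and cB: "continuous_on K B"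
    and B0: "\<And>z. z \<in> K \<Longrightarrow> B z \<ge> 0"
    and uniq: "\<And>z. z \<in> K \<Longrightarrow> B z = 0 \<Longrightarrow> A z \<le> C \<Longrightarrow> z = zbar"
    and zs: "\<And>k. zs k \<in> K" and le: "\<And>k. A (zs k) + real (Suc k) * B (zs k) \<le> C"
  obtains r where "strict_mono r" "(zs \<circ> r) \<longlonglongrightarrow> zbar"
proof -
  obtain z r where z: "z \<in> K" and r: "strict_mono r" and lim: "(zs \<circ> r) \<longlonglongrightarrow> z"
    using K zs unfolding compact_def by meson
  have "K \<noteq> {}" using z by auto
  then obtain z0 where z0: "\<And>z. z \<in> K \<Longrightarrow> A z0 \<le> A z"
    using continuous_attains_inf[OF K _ cA] by blast
  have Alim: "(\<lambda>k. A (zs (r k))) \<longlonglongrightarrow> A z"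
    using continuous_on_tendsto_compose[OF cA lim z] zs by (simp add: o_def)
  have Blim: "(\<lambda>k. B (zs (r k))) \<longlonglongrightarrow> B z"
    using continuous_on_tendsto_compose[OF cB lim z] zs by (simp add: o_def)
  have "B (zs k) \<le> (C - A z0) / real (Suc k)" for k
    using le[of k] z0[OF zs[of k]] by (simp add: field_simps)
  moreover have "(\<lambda>k. (C - A z0) / real (Suc (r k))) \<longlonglongrightarrow> 0"
  proof -
    have "(\<lambda>k. (C - A z0) / real (Suc k)) \<longlonglongrightarrow> 0"
      by (intro LIMSEQ_Suc[where f = "\<lambda>k. (C - A z0) / real k"] lim_const_over_n)
    from LIMSEQ_subseq_LIMSEQ[OF this r] show ?thesis by (simp add: o_def)
  qed
  ultimately have "B z \<le> 0"
    using LIMSEQ_le[OF Blim] by blast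
  with B0[OF z] have "B z = 0" by simp
  moreover have "A z \<le> C"
  proof (rule LIMSEQ_le_const2[OF Alim], intro exI allI impI)
    fix k
    have "0 \<le> real (Suc (r k)) * B (zs (r k))" using B0[OF zs] by simp
    with le[of "r k"] show "A (zs (r k)) \<le> C" by linarith
  qed
  ultimately have "z = zbar" using uniq z by blast
  with that r lim show thesis by blast
qed

lemma compact_vec_box:
  fixes K :: "'a::euclidean_space set"
  assumes "compact K"
  shows "compact {X :: 'a ^ 'm. \<forall>i. X $ i \<in> K}"
proof -
  have "closed {X :: 'a ^ 'm. \<forall>i. X $ i \<in> K}"
    using compact_imp_closed[OF assms]
    by (auto intro!: closed_Collect_all closed_vimage_vec_nth simp: vimage_def[symmetric])
  moreover have "bounded {X :: 'a ^ 'm. \<forall>i. X $ i \<in> K}"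
  proof -
    obtain M where M: "\<And>x. x \<in> K \<Longrightarrow> norm x \<le> M"
      using compact_imp_bounded[OF assms] unfolding bounded_iff by blast
    have "norm X \<le> real CARD('m) * M" if "\<forall>i. X $ i \<in> K" for X :: "'a ^ 'm"
    proof -
      have "norm X \<le> (\<Sum>i\<in>UNIV. norm (X $ i))"
        unfolding norm_vec_def by (rule L2_set_le_sum) simp
      also have "\<dots> \<le> (\<Sum>i\<in>(UNIV::'m set). M)"
        by (intro sum_mono M) (use that in simp)
      finally show ?thesis by simp
    qed
    then show ?thesis unfolding bounded_iff by blast
  qed
  ultimately show ?thesis by (simp add: compact_eq_bounded_closed)
qed

text \<open>The right side, as a function of \<open>t\<close>, is the parabola tangent to the
  squared positive part at \<open>t = s\<close>. It is a smooth majorant, so the penalty can be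
  handled without differentiating \<open>max\<close>.\<close>

lemma max0_square_le: "(max 0 t)\<^sup>2 \<le> (max 0 s + (t - s))\<^sup>2" for s t :: real
proof (cases "t \<ge> 0")
  case True
  then show ?thesis by (intro power_mono) auto
qed simp

lemma locally_lipschitz_isCont:
  assumes "locally_lipschitz f"
  shows "isCont f x"
proof -
  obtain U L where "open U" "x \<in> U" "L-lipschitz_on U f"
    using assms unfolding locally_lipschitz_def by blast
  then show ?thesis
    using lipschitz_on_continuous_on continuous_on_eq_continuous_at by blast
qed

lemma lipschitz_on_vec_nth:
  fixes f :: "'a::metric_space \<Rightarrow> real ^ 'm"
  assumes "L-lipschitz_on U f"
  shows "L-lipschitz_on U (\<lambda>x. f x $ i)"
proof (rule lipschitz_onI)
  fix x y
  assume "x \<in> U" "y \<in> U"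
  then show "dist (f x $ i) (f y $ i) \<le> L * dist x y"
    using lipschitz_onD[OF assms] dist_vec_nth_le order_trans by blast
qed (rule lipschitz_on_nonneg[OF assms])


section \<open>The multiplier rule by decoupling and quadratic penalties\<close>

text \<open>Replacing \<open>\<phi> y\<close> by a free height \<open>s\<close> above the graph
  makes the objective smooth. It is nondecreasing in \<open>s\<close>, so the minimum over
  \<open>U\<close> becomes a local minimum over the epigraph, to which Fermat's rule
  applies.\<close>

lemma penalized_epi_normal:
  fixes \<phi> :: "'a::real_inner \<Rightarrow> real"
  assumes U: "open U" "x \<in> U" and k: "k \<ge> 0"
    and min: "\<And>y. y \<in> U \<Longrightarrow>
      \<phi> x + k * ((max 0 (\<phi> x - b))\<^sup>2 + (x - u) \<bullet> (x - u))
      \<le> \<phi> y + k * ((max 0 (\<phi> y - b))\<^sup>2 + (y - u) \<bullet> (y - u))"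
  shows "((2 * k) *\<^sub>R (u - x), - (1 + 2 * k * max 0 (\<phi> x - b)))
    \<in> regular_normal_cone (x, \<phi> x) (epi \<phi>)"
proof -
  define m where "m = max 0 (\<phi> x - b)"
  \<comment> \<open>Replacing the squared positive part by its tangent parabola from above keeps the minimum.\<close>
  define F where "F = (\<lambda>z :: 'a \<times> real.
    snd z + k * ((m + (snd z - \<phi> x))\<^sup>2 + (fst z - u) \<bullet> (fst z - u)))"
  define G where "G = ((2 * k) *\<^sub>R (x - u), 1 + 2 * k * m)"
  have "(F has_derivative (\<lambda>d. G \<bullet> d)) (at (x, \<phi> x) within epi \<phi>)"
    unfolding F_def G_def
    by (auto intro!: derivative_eq_intros simp: inner_prod_def algebra_simps inner_commute)
  moreover have "\<forall>\<^sub>F z in at (x, \<phi> x) within epi \<phi>. F (x, \<phi> x) \<le> F z"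
  proof -
    have "(fst \<longlongrightarrow> x) (at (x, \<phi> x) within epi \<phi>)"
      by (rule tendsto_eq_intros refl)+ simp
    then have "\<forall>\<^sub>F z in at (x, \<phi> x) within epi \<phi>. fst z \<in> U"
      using U by (rule topological_tendstoD)
    moreover have "\<forall>\<^sub>F z in at (x, \<phi> x) within epi \<phi>. z \<in> epi \<phi>"
      by (simp add: eventually_at_filter)
    ultimately show ?thesis
    proof eventually_elim
      case (elim z)
      obtain y s where z: "z = (y, s)" by (cases z)
      with elim have y: "y \<in> U" and s: "\<phi> y \<le> s" by (auto simp: epi_def)
      have "F (x, \<phi> x) \<le> \<phi> y + k * ((max 0 (\<phi> y - b))\<^sup>2 + (y - u) \<bullet> (y - u))"
        using min[OF y] by (simp add: F_def m_def)
      also have "\<dots> \<le> s + k * ((max 0 (s - b))\<^sup>2 + (y - u) \<bullet> (y - u))"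
        using s k by (intro add_mono mult_left_mono power_mono) auto
      also have "\<dots> \<le> s + k * ((m + (s - \<phi> x))\<^sup>2 + (y - u) \<bullet> (y - u))"
        using max0_square_le[of "s - b" "\<phi> x - b"] k
        by (intro add_mono mult_left_mono) (auto simp: m_def)
      finally show ?case by (simp add: F_def z)
    qed
  qed
  ultimately have "- G \<in> regular_normal_cone (x, \<phi> x) (epi \<phi>)"
    by (rule neg_gradient_regular_normal)
  then show ?thesis
    by (simp add: G_def m_def scaleR_diff_right)
qed

text \<open>
  Each \<open>f\<^sub>i\<close> gets its own copy of the variable, tied to a point of \<open>\<Omega>\<close> by a quadratic penalty, so
  stationarity splits into normals to the epigraphs and to \<open>\<Omega>\<close>. Because \<open>f\<^sub>i\<close> occurs both in the
  objective and in the constraint \<open>f\<^sub>i \<le> ybar\<^sub>i\<close>, its multiplier before normalization is at least \<open>1\<close>;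
  so no epigraph normal is horizontal, and a single subgradient serves both occurrences although
  the limiting subdifferential is not convex.
\<close>

lemma multiplier_rule:
  fixes f :: "'a::euclidean_space \<Rightarrow> real ^ 'm" and h e :: "'a \<Rightarrow> real"
  assumes f: "locally_lipschitz f" and cl: "closed \<Omega>" and xbar: "xbar \<in> \<Omega>"
    and feas: "f xbar \<le> ybar" "e xbar = 0"
    and h: "\<And>x. (h has_derivative (\<lambda>d. H x \<bullet> d)) (at x)" and H: "isCont H xbar"
    and e: "\<And>x. (e has_derivative (\<lambda>d. E x \<bullet> d)) (at x)" and E: "isCont E xbar"
    and min: "\<And>x. x \<in> \<Omega> \<Longrightarrow> f x \<le> ybar \<Longrightarrow> e x = 0 \<Longrightarrow>
      (\<Sum>i\<in>UNIV. f xbar $ i) + h xbar \<le> (\<Sum>i\<in>UNIV. f x $ i) + h x"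
  obtains v :: "'m \<Rightarrow> 'a" and l :: "real ^ 'm" and \<mu> \<alpha> :: real and w :: 'a
  where "\<And>i. v i \<in> symmetric_subdiff (\<lambda>x. f x $ i) xbar"
    and "l \<in> nonneg_orthant" "(\<Sum>i\<in>UNIV. l $ i) + \<bar>\<mu>\<bar> = 1" "0 \<le> \<alpha>" "\<alpha> \<le> 1"
    and "w \<in> limiting_normal_cone xbar \<Omega>"
    and "(\<Sum>i\<in>UNIV. l $ i *\<^sub>R v i) + \<mu> *\<^sub>R E xbar + \<alpha> *\<^sub>R H xbar + w = 0"
    and "(\<forall>x. e x = 0) \<longrightarrow> \<mu> = 0"
proof -
  \<comment> \<open>The unit balls only serve compactness: the minimizers converge to
    \<open>xbar\<close>, so eventually they lie in the interior and the balls impose no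
    constraint.\<close>
  define K where "K = {X :: 'a ^ 'm. \<forall>i. X $ i \<in> cball xbar 1} \<times> (\<Omega> \<inter> cball xbar 1)"
  \<comment> \<open>The last summand singles out \<open>xbar\<close> among all minimizers of the
    original problem, which forces convergence to it; its gradient \<open>2 (u - xbar)\<close>
    vanishes in the limit.\<close>
  define A where "A = (\<lambda>z. (\<Sum>i\<in>UNIV. f (fst z $ i) $ i) + h (snd z) + (snd z - xbar) \<bullet> (snd z - xbar))"
  \<comment> \<open>\<open>B\<close> vanishes exactly when all copies agree with the point
    \<open>u\<close> of \<open>\<Omega>\<close> and \<open>u\<close> satisfies both
    constraints.\<close>
  define B where "B = (\<lambda>z. (\<Sum>i\<in>UNIV. (max 0 (f (fst z $ i) $ i - ybar $ i))\<^sup>2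
      + (fst z $ i - snd z) \<bullet> (fst z $ i - snd z)) + (e (snd z))\<^sup>2)"
  define zbar :: "('a ^ 'm) \<times> 'a" where "zbar = ((\<chi> i. xbar), xbar)"
  define C where "C = (\<Sum>i\<in>UNIV. f xbar $ i) + h xbar"
  have K: "compact K"
    unfolding K_def using cl
    by (intro compact_Times compact_vec_box closed_Int_compact compact_cball)
  have cf: "continuous_on UNIV f"
    using locally_lipschitz_isCont[OF f] by (simp add: continuous_at_imp_continuous_on)
  have ch: "continuous_on UNIV h" and ce: "continuous_on UNIV e"
    using h e by (auto intro!: continuous_at_imp_continuous_on has_derivative_continuous)
  have cA: "continuous_on S A" and cB: "continuous_on S B" for S
    unfolding A_def B_def
    by (intro continuous_intros continuous_on_compose2[OF cf] continuous_on_compose2[OF ch]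
        continuous_on_compose2[OF ce]; simp)+
  have zbar: "zbar \<in> K" "A zbar = C" "B zbar = 0"
    using xbar feas by (simp_all add: zbar_def K_def A_def B_def C_def less_eq_vec_def max_absorb1)
  have "\<exists>z\<in>K. \<forall>z'\<in>K. A z + real (Suc k) * B z \<le> A z' + real (Suc k) * B z'" for k
    using zbar(1) by (intro continuous_attains_inf K continuous_intros cA cB) auto
  then obtain zs where zs: "\<And>k. zs k \<in> K"
    and zmin: "\<And>k z. z \<in> K \<Longrightarrow> A (zs k) + real (Suc k) * B (zs k) \<le> A z + real (Suc k) * B z"
    by metis
  have B0: "B z \<ge> 0" for z
    by (auto simp: B_def intro!: add_nonneg_nonneg sum_nonneg)
  have uniq: "z = zbar" if z: "z \<in> K" "B z = 0" "A z \<le> C" for z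
  proof -
    obtain X u where Xu: "z = (X, u)" by (cases z)
    have "(\<Sum>i\<in>UNIV. (max 0 (f (X $ i) $ i - ybar $ i))\<^sup>2 + (X $ i - u) \<bullet> (X $ i - u)) = 0 \<and> (e u)\<^sup>2 = 0"
      using z(2) unfolding B_def Xu
      by (subst (asm) add_nonneg_eq_0_iff) (auto intro!: sum_nonneg)
    then have *: "(max 0 (f (X $ i) $ i - ybar $ i))\<^sup>2 + (X $ i - u) \<bullet> (X $ i - u) = 0" "e u = 0" for i
      by (simp_all add: sum_nonneg_eq_0_iff)
    have Xi: "X $ i = u" for i
      using *(1)[of i] by (simp add: add_nonneg_eq_0_iff)
    have "max 0 (f u $ i - ybar $ i) = 0" for i
      using *(1)[of i] by (simp add: add_nonneg_eq_0_iff Xi)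
    then have "f u $ i - ybar $ i \<le> 0" for i by (metis max.cobounded2)
    then have "f u \<le> ybar" by (simp add: less_eq_vec_def)
    moreover have "u \<in> \<Omega>" using z(1) by (simp add: K_def Xu)
    ultimately have "C \<le> (\<Sum>i\<in>UNIV. f u $ i) + h u" using min *(2) by (simp add: C_def)
    moreover have "A z = (\<Sum>i\<in>UNIV. f u $ i) + h u + (u - xbar) \<bullet> (u - xbar)"
      by (simp add: A_def Xu Xi)
    ultimately have "(u - xbar) \<bullet> (u - xbar) \<le> 0" using z(3) by linarith
    then have "u = xbar" by (metis inner_gt_zero_iff not_le right_minus_eq)
    with Xi show ?thesis by (simp add: Xu zbar_def vec_eq_iff)
  qed
  have le: "A (zs k) + real (Suc k) * B (zs k) \<le> C" for k
    using zmin[OF zbar(1), of k] zbar(2,3) by simp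
  obtain r where r: "strict_mono r" and lim: "(zs \<circ> r) \<longlonglongrightarrow> zbar"
    using penalty_method_converges[OF K cA cB B0 uniq zs le] by blast
  obtain U L where U: "open U" "xbar \<in> U" and L: "L-lipschitz_on U f"
    using f unfolding locally_lipschitz_def by blast
  have Xlim0: "(\<lambda>j. fst (zs (r j)) $ i) \<longlonglongrightarrow> xbar" for i
    using tendsto_vec_nth[OF tendsto_fst[OF lim], of i] by (simp add: zbar_def o_def)
  have ulim0: "(\<lambda>j. snd (zs (r j))) \<longlonglongrightarrow> xbar"
    using tendsto_snd[OF lim] by (simp add: zbar_def o_def)
  \<comment> \<open>From here on the tail of the subsequence is used: inside the open balls, for
    stationarity, and with the copies in \<open>U\<close>, where the Lipschitz constant is
    available.\<close>
  have "\<forall>\<^sub>F j in sequentially. (\<forall>i. fst (zs (r j)) $ i \<in> U \<inter> ball xbar 1) \<and> snd (zs (r j)) \<in> ball xbar 1"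
    using U
    by (intro eventually_conj eventually_all_finite topological_tendstoD[OF Xlim0]
        topological_tendstoD[OF ulim0]) auto
  then obtain N where N: "\<And>j. j \<ge> N \<Longrightarrow>
      (\<forall>i. fst (zs (r j)) $ i \<in> U \<inter> ball xbar 1) \<and> snd (zs (r j)) \<in> ball xbar 1"
    unfolding eventually_sequentially by blast
  define X where "X = (\<lambda>j. fst (zs (r (j + N))))"
  define u where "u = (\<lambda>j. snd (zs (r (j + N))))"
  define \<kappa> where "\<kappa> = (\<lambda>j. real (Suc (r (j + N))))"
  have Xlim: "(\<lambda>j. X j $ i) \<longlonglongrightarrow> xbar" for i
    using LIMSEQ_ignore_initial_segment[OF Xlim0] by (simp add: X_def)
  have ulim: "u \<longlonglongrightarrow> xbar"
    using LIMSEQ_ignore_initial_segment[OF ulim0] by (simp add: u_def)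
  have XU: "X j $ i \<in> U" "X j $ i \<in> ball xbar 1" and uball: "u j \<in> ball xbar 1"
    and u\<Omega>: "u j \<in> \<Omega>" for i j
    using N[of "j + N"] zs[of "r (j + N)"] by (auto simp: X_def u_def K_def)
  have \<kappa>: "\<kappa> j \<ge> 0" for j by (simp add: \<kappa>_def)
  have Xumin: "A (X j, u j) + \<kappa> j * B (X j, u j) \<le> A z + \<kappa> j * B z" if "z \<in> K" for j z
    using zmin[OF that] by (simp add: X_def u_def \<kappa>_def)
  \<comment> \<open>Multipliers before normalization. In \<open>a\<close>, the 1 comes from the
    objective and the rest from the penalty on \<open>f\<^sub>i \<le> ybar\<^sub>i\<close>;
    \<open>p\<close> is the gradient of the coupling penalty with respect to \<open>u\<close>, hence
    minus its gradient with respect to the copy; \<open>\<mu>\<close> comes from the penalty on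
    \<open>e\<close>.\<close>
  define a where "a = (\<lambda>j i. 1 + 2 * \<kappa> j * max 0 (f (X j $ i) $ i - ybar $ i))"
  define p where "p = (\<lambda>j i. (2 * \<kappa> j) *\<^sub>R (u j - X j $ i))"
  define \<mu> where "\<mu> = (\<lambda>j. 2 * \<kappa> j * e (u j))"
  have a1: "a j i \<ge> 1" for j i using \<kappa>[of j] by (simp add: a_def)
  have epi_normal: "(p j i, - a j i) \<in> regular_normal_cone (X j $ i, f (X j $ i) $ i) (epi (\<lambda>x. f x $ i))"
    for j i
    unfolding p_def a_def
  proof (rule penalized_epi_normal[where U = "ball xbar 1"])
    fix y assume y: "y \<in> ball xbar 1"
    define g where "g = (\<lambda>i x. f x $ i + \<kappa> j * ((max 0 (f x $ i - ybar $ i))\<^sup>2 + (x - u j) \<bullet> (x - u j)))"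
    \<comment> \<open>Only the copy with index \<open>i\<close> moves; all other summands cancel in
      the comparison, leaving a minimum in one variable.\<close>
    define Y where "Y = (\<chi> i'. if i' = i then y else X j $ i')"
    have "(Y, u j) \<in> K"
      using y XU(2)[of j] uball u\<Omega> by (auto simp: K_def Y_def less_imp_le)
    moreover have split: "A (Z, u j) + \<kappa> j * B (Z, u j) = (\<Sum>i\<in>UNIV. g i (Z $ i))
        + (h (u j) + (u j - xbar) \<bullet> (u j - xbar) + \<kappa> j * (e (u j))\<^sup>2)" for Z
      by (simp add: A_def B_def g_def sum.distrib sum_distrib_left distrib_left add_ac)
    ultimately have "(\<Sum>i\<in>UNIV. g i (X j $ i)) \<le> (\<Sum>i\<in>UNIV. g i (Y $ i))"
      using Xumin[of "(Y, u j)" j] by simp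
    also have "(\<Sum>i\<in>UNIV. g i (Y $ i)) = g i y + (\<Sum>i\<in>UNIV - {i}. g i (X j $ i))"
      by (subst sum.remove[of _ i]) (auto simp: Y_def intro!: sum.cong)
    also have "(\<Sum>i\<in>UNIV. g i (X j $ i)) = g i (X j $ i) + (\<Sum>i\<in>UNIV - {i}. g i (X j $ i))"
      by (subst sum.remove[of _ i]) auto
    finally show "f (X j $ i) $ i + \<kappa> j * ((max 0 (f (X j $ i) $ i - ybar $ i))\<^sup>2
          + (X j $ i - u j) \<bullet> (X j $ i - u j))
        \<le> f y $ i + \<kappa> j * ((max 0 (f y $ i - ybar $ i))\<^sup>2 + (y - u j) \<bullet> (y - u j))"
      by (simp add: g_def)
  qed (use XU \<kappa> in auto)
  have \<Omega>_normal: "- (H (u j) + \<mu> j *\<^sub>R E (u j) + (\<Sum>i\<in>UNIV. p j i) + 2 *\<^sub>R (u j - xbar))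
      \<in> regular_normal_cone (u j) \<Omega>" for j
  proof (rule neg_gradient_regular_normal)
    \<comment> \<open>Now the copies are frozen and \<open>u\<close> moves in
      \<open>\<Omega>\<close>: these are the terms of the penalized objective that depend on
      \<open>u\<close>.\<close>
    let ?F = "\<lambda>y. h y + \<kappa> j * (e y)\<^sup>2 + (\<Sum>i\<in>UNIV. \<kappa> j * ((X j $ i - y) \<bullet> (X j $ i - y)))
        + (y - xbar) \<bullet> (y - xbar)"
    show "(?F has_derivative (\<lambda>d. (H (u j) + \<mu> j *\<^sub>R E (u j) + (\<Sum>i\<in>UNIV. p j i)
        + 2 *\<^sub>R (u j - xbar)) \<bullet> d)) (at (u j) within \<Omega>)"
      by (rule derivative_eq_intros has_derivative_at_withinI[OF h] has_derivative_at_withinI[OF e] refl)+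
        (auto simp: fun_eq_iff \<mu>_def p_def inner_sum_left inner_sum_right inner_commute algebra_simps intro!: sum.cong)
    have "\<forall>\<^sub>F y in at (u j) within \<Omega>. y \<in> ball xbar 1"
      using uball by (intro topological_tendstoD[where f = "\<lambda>y. y"] tendsto_ident_at) auto
    moreover have "\<forall>\<^sub>F y in at (u j) within \<Omega>. y \<in> \<Omega>"
      by (simp add: eventually_at_filter)
    ultimately show "\<forall>\<^sub>F y in at (u j) within \<Omega>. ?F (u j) \<le> ?F y"
    proof eventually_elim
      case (elim y)
      then have "(X j, y) \<in> K"
        using XU(2)[of j] by (auto simp: K_def less_imp_le)
      from Xumin[OF this, of j] show ?case
        by (simp add: A_def B_def sum.distrib sum_distrib_left distrib_left add_ac)
    qed
  qed
  \<comment> \<open>The multipliers may blow up with the penalty weight, so they are divided by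
    their total. Since every \<open>a j i\<close> is at least 1, so is \<open>\<tau> j\<close>, and
    the factor \<open>1 / \<tau> j\<close> left in front of the smooth term lies between 0 and
    1.\<close>
  define \<tau> where "\<tau> = (\<lambda>j. (\<Sum>i\<in>UNIV. a j i) + \<bar>\<mu> j\<bar>)"
  have \<tau>1: "\<tau> j \<ge> 1" and \<tau>a: "\<tau> j \<ge> a j i" and \<tau>\<mu>: "\<tau> j \<ge> \<bar>\<mu> j\<bar>" for j i
  proof -
    have "a j i \<le> (\<Sum>i\<in>UNIV. a j i)" for i
      using a1[of j] by (intro member_le_sum) (auto intro: order_trans[OF zero_le_one])
    then show "\<tau> j \<ge> a j i" for i by (simp add: \<tau>_def add_increasing2)
    then show "\<tau> j \<ge> 1" using a1[of j i] order_trans by blast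
    show "\<tau> j \<ge> \<bar>\<mu> j\<bar>"
      using a1[of j] by (auto simp: \<tau>_def intro!: sum_nonneg intro: order_trans[OF zero_le_one])
  qed
  \<comment> \<open>Dividing by \<open>a j i\<close> makes the vertical component of the normal
    \<open>-1\<close>, so \<open>v\<close> is a genuine subgradient and is bounded by the Lipschitz
    constant.\<close>
  define v where "v = (\<lambda>j i. (1 / a j i) *\<^sub>R p j i)"
  have v_normal: "(v j i, -1) \<in> regular_normal_cone (X j $ i, f (X j $ i) $ i) (epi (\<lambda>x. f x $ i))" for j i
    using regular_normal_cone_scaleR[OF epi_normal, of "1 / a j i" j i] a1[of j i]
    by (simp add: v_def)
  have v_bound: "norm (v j i) \<le> L" for j i
    using regular_normal_epi_bound[OF lipschitz_on_vec_nth[OF L] U(1) XU(1) v_normal] .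
  \<comment> \<open>Subgradients and normalized multipliers are packed together so that one
    compactness argument yields a common convergent subsequence; \<open>\<alpha>\<close> will be the
    limit of \<open>1 / \<tau>\<close>.\<close>
  define D where "D = (\<lambda>j. ((\<chi> i. v j i), (\<chi> i. a j i / \<tau> j) :: real ^ 'm, \<mu> j / \<tau> j, 1 / \<tau> j))"
  define Q where "Q = {V :: 'a ^ 'm. \<forall>i. V $ i \<in> cball 0 L} \<times> {l :: real ^ 'm. \<forall>i. l $ i \<in> {0..1}}
      \<times> {-1..1::real} \<times> {0..1::real}"
  have "D j \<in> Q" for j
  proof -
    have "0 < \<tau> j" "\<And>i. 0 \<le> a j i"
      using \<tau>1[of j] a1[of j] by (auto intro: order_trans[OF zero_le_one])
    then show ?thesis
      using v_bound[of j] \<tau>1[of j] \<tau>a[of j] \<tau>\<mu>[of j] by (auto simp: D_def Q_def field_simps abs_le_iff)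
  qed
  moreover have "compact Q"
    unfolding Q_def by (intro compact_Times compact_vec_box compact_cball compact_Icc)
  ultimately obtain q s where q: "q \<in> Q" and s: "strict_mono s" and Dlim: "(D \<circ> s) \<longlonglongrightarrow> q"
    unfolding compact_def by meson
  obtain V l \<mu>\<^sub>0 \<alpha> where qV: "q = (V, l, \<mu>\<^sub>0, \<alpha>)" by (cases q) auto
  have vlim: "(\<lambda>j. v (s j) i) \<longlonglongrightarrow> V $ i" and llim: "(\<lambda>j. a (s j) i / \<tau> (s j)) \<longlonglongrightarrow> l $ i" for i
    using tendsto_vec_nth[OF tendsto_fst[OF Dlim], of i]
      tendsto_vec_nth[OF tendsto_fst[OF tendsto_snd[OF Dlim]], of i]
    by (simp_all add: D_def qV o_def)
  have \<mu>lim: "(\<lambda>j. \<mu> (s j) / \<tau> (s j)) \<longlonglongrightarrow> \<mu>\<^sub>0" and \<alpha>lim: "(\<lambda>j. 1 / \<tau> (s j)) \<longlonglongrightarrow> \<alpha>"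
    using tendsto_fst[OF tendsto_snd[OF tendsto_snd[OF Dlim]]]
      tendsto_snd[OF tendsto_snd[OF tendsto_snd[OF Dlim]]]
    by (simp_all add: D_def qV o_def)
  have Xs: "(\<lambda>j. X (s j) $ i) \<longlonglongrightarrow> xbar" for i
    using LIMSEQ_subseq_LIMSEQ[OF Xlim s] by (simp add: o_def)
  have us: "(\<lambda>j. u (s j)) \<longlonglongrightarrow> xbar"
    using LIMSEQ_subseq_LIMSEQ[OF ulim s] by (simp add: o_def)
  \<comment> \<open>The stationarity equation holds by this choice; what remains is that
    \<open>w\<close> is a limiting normal, as the limit of the scaled regular normals at
    \<open>u (s j)\<close>.\<close>
  define w where "w = - ((\<Sum>i\<in>UNIV. l $ i *\<^sub>R V $ i) + \<mu>\<^sub>0 *\<^sub>R E xbar + \<alpha> *\<^sub>R H xbar)"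
  show thesis
  proof (rule that)
    fix i
    show "V $ i \<in> symmetric_subdiff (\<lambda>x. f x $ i) xbar"
      unfolding symmetric_subdiff_def limiting_subdiff_def
    proof (intro UnI1 CollectI limiting_normal_coneI)
      show "(\<lambda>j. (X (s j) $ i, f (X (s j) $ i) $ i)) \<longlonglongrightarrow> (xbar, f xbar $ i)"
        using Xs by (intro tendsto_intros isCont_tendsto_compose[OF locally_lipschitz_isCont[OF f]])
      show "(\<lambda>j. (v (s j) i, -1)) \<longlonglongrightarrow> (V $ i, -1)"
        by (intro tendsto_intros vlim)
    qed (use v_normal in \<open>auto simp: epi_def\<close>)
  next
    show "l \<in> nonneg_orthant" "0 \<le> \<alpha>" "\<alpha> \<le> 1"
      using q by (auto simp: qV Q_def nonneg_orthant_def)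
    have "(\<Sum>i\<in>UNIV. a j i / \<tau> j) + \<bar>\<mu> j / \<tau> j\<bar> = 1" for j
      using \<tau>1[of j] by (simp add: sum_divide_distrib[symmetric] add_divide_distrib[symmetric]) (simp add: \<tau>_def)
    moreover have "(\<lambda>j. (\<Sum>i\<in>UNIV. a (s j) i / \<tau> (s j)) + \<bar>\<mu> (s j) / \<tau> (s j)\<bar>)
        \<longlonglongrightarrow> (\<Sum>i\<in>UNIV. l $ i) + \<bar>\<mu>\<^sub>0\<bar>"
      by (intro tendsto_intros llim \<mu>lim)
    ultimately have "(\<lambda>j. 1::real) \<longlonglongrightarrow> (\<Sum>i\<in>UNIV. l $ i) + \<bar>\<mu>\<^sub>0\<bar>" by simp
    then show "(\<Sum>i\<in>UNIV. l $ i) + \<bar>\<mu>\<^sub>0\<bar> = 1"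
      using LIMSEQ_unique tendsto_const by blast
    show "(\<Sum>i\<in>UNIV. l $ i *\<^sub>R V $ i) + \<mu>\<^sub>0 *\<^sub>R E xbar + \<alpha> *\<^sub>R H xbar + w = 0"
      by (simp add: w_def)
    show "(\<forall>x. e x = 0) \<longrightarrow> \<mu>\<^sub>0 = 0"
      using \<mu>lim by (auto simp: \<mu>_def LIMSEQ_const_iff)
    show "w \<in> limiting_normal_cone xbar \<Omega>"
    proof (rule limiting_normal_coneI)
      let ?w = "\<lambda>j. - ((\<Sum>i\<in>UNIV. (a j i / \<tau> j) *\<^sub>R v j i) + (\<mu> j / \<tau> j) *\<^sub>R E (u j)
          + (1 / \<tau> j) *\<^sub>R (H (u j) + 2 *\<^sub>R (u j - xbar)))"
      have "(\<lambda>j. ?w (s j)) \<longlonglongrightarrow> - ((\<Sum>i\<in>UNIV. l $ i *\<^sub>R V $ i) + \<mu>\<^sub>0 *\<^sub>R E xbar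
          + \<alpha> *\<^sub>R (H xbar + 2 *\<^sub>R (xbar - xbar)))"
        by (intro tendsto_intros llim vlim \<mu>lim \<alpha>lim isCont_tendsto_compose[OF E us]
            isCont_tendsto_compose[OF H us] us)
      then show "(\<lambda>j. ?w (s j)) \<longlonglongrightarrow> w" by (simp add: w_def)
      \<comment> \<open>Since \<open>a j i * v j i\<close> is \<open>p j i\<close>, the copies'
        terms turn into the coupling gradients in the normal to \<open>\<Omega>\<close>.\<close>
      have w_eq: "?w j = (1 / \<tau> j) *\<^sub>R (- (H (u j) + \<mu> j *\<^sub>R E (u j) + (\<Sum>i\<in>UNIV. p j i) + 2 *\<^sub>R (u j - xbar)))" for j
      proof -
        have "(a j i / \<tau> j) *\<^sub>R v j i = (1 / \<tau> j) *\<^sub>R p j i" for i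
          using a1[of j i] by (simp add: v_def)
        then show ?thesis by (simp add: scaleR_sum_right algebra_simps)
      qed
      have "0 \<le> 1 / \<tau> j" for j using \<tau>1[of j] by simp
      then show "\<forall>\<^sub>F j in sequentially. ?w (s j) \<in> regular_normal_cone (u (s j)) \<Omega>"
        unfolding w_eq
        by (intro always_eventually allI regular_normal_cone_scaleR[OF \<Omega>_normal])
    qed (use u\<Omega> us in auto)
  qed
qed


section \<open>The Rabier function, scalarization, and minimizers on sections\<close>

text \<open>The witness gives the upper bound and also makes the set of norms nonempty, which the
  lower bound for the real-valued \<open>Inf\<close> requires.\<close>

lemma rabier_nonneg_le:
  fixes f :: "'a::real_inner \<Rightarrow> real ^ 'm"
  assumes "\<And>i. v i \<in> symmetric_subdiff (\<lambda>z. f z $ i) x"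
    and "w \<in> limiting_normal_cone x \<Omega>" "l \<in> nonneg_orthant" "(\<Sum>i\<in>UNIV. l $ i) = 1"
  shows "0 \<le> rabier f \<Omega> x" "rabier f \<Omega> x \<le> norm ((\<Sum>i\<in>UNIV. l $ i *\<^sub>R v i) + w)"
proof -
  define R where "R = {norm ((\<Sum>i\<in>UNIV. l $ i *\<^sub>R v i) + w) | (v :: 'm \<Rightarrow> 'a) w (l :: real ^ 'm).
    (\<forall>i. v i \<in> symmetric_subdiff (\<lambda>z. f z $ i) x) \<and> w \<in> limiting_normal_cone x \<Omega> \<and>
    l \<in> nonneg_orthant \<and> (\<Sum>i\<in>UNIV. l $ i) = 1}"
  have mem: "norm ((\<Sum>i\<in>UNIV. l $ i *\<^sub>R v i) + w) \<in> R"
    using assms unfolding R_def by blast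
  have nonneg: "\<And>t. t \<in> R \<Longrightarrow> 0 \<le> t" by (auto simp: R_def)
  have "rabier f \<Omega> x = Inf R" by (simp add: rabier_def R_def)
  then show "0 \<le> rabier f \<Omega> x" "rabier f \<Omega> x \<le> norm ((\<Sum>i\<in>UNIV. l $ i *\<^sub>R v i) + w)"
    using mem nonneg by (auto intro!: cInf_greatest cInf_lower bdd_belowI)
qed

text \<open>Its image under \<open>f\<close> is the section at \<open>y\<close>.\<close>

definition section_domain :: "('a \<Rightarrow> real ^ 'm) \<Rightarrow> 'a set \<Rightarrow> real ^ 'm \<Rightarrow> 'a set" where
  "section_domain f \<Omega> y = {x \<in> \<Omega>. f x \<le> y}"

definition component_sum :: "('a \<Rightarrow> real ^ 'm) \<Rightarrow> 'a \<Rightarrow> real" where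
  "component_sum f x = (\<Sum>i\<in>UNIV. f x $ i)"

lemma component_sum_strict_mono:
  assumes "f x \<le> f y" "f x \<noteq> f y"
  shows "component_sum f x < component_sum f y"
proof -
  obtain i where "f x $ i < f y $ i"
    using assms by (metis less_eq_vec_def order_less_le vec_eq_iff)
  with assms(1) show ?thesis
    unfolding component_sum_def by (intro sum_strict_mono_ex1) (auto simp: less_eq_vec_def)
qed

text \<open>A point that dominates \<open>x\<close> lies in the same section by transitivity and has
  a strictly smaller sum.\<close>

lemma pareto_efficient_if_minimizes_component_sum:
  assumes x: "x \<in> section_domain f \<Omega> ybar"
    and min: "\<And>z. z \<in> section_domain f \<Omega> ybar \<Longrightarrow> component_sum f x \<le> component_sum f z"
  shows "pareto_efficient f \<Omega> x"
  unfolding pareto_efficient_def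
proof (intro conjI notI)
  assume "\<exists>z\<in>\<Omega>. f z \<le> f x \<and> f z \<noteq> f x"
  then obtain z where z: "z \<in> \<Omega>" "f z \<le> f x" "f z \<noteq> f x" by blast
  with x have "z \<in> section_domain f \<Omega> ybar" by (auto simp: section_domain_def)
  with min component_sum_strict_mono[of f z x] z show False by (meson not_le)
qed (use x in \<open>simp add: section_domain_def\<close>)

text \<open>With the trivial constraint \<open>e = 0\<close> the rule gives
  \<open>\<mu> = 0\<close>, so the weights sum to 1 and form a candidate for the infimum. Its
  residual is \<open>- \<alpha> H x\<close> with \<open>\<alpha> \<le> 1\<close>.\<close>

lemma rabier_at_perturbed_minimizer:
  fixes f :: "'a::euclidean_space \<Rightarrow> real ^ 'm"
  assumes f: "locally_lipschitz f" and cl: "closed \<Omega>" and x: "x \<in> section_domain f \<Omega> ybar"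
    and h: "\<And>x. (h has_derivative (\<lambda>d. H x \<bullet> d)) (at x)" and H: "isCont H x"
    and min: "\<And>z. z \<in> section_domain f \<Omega> ybar \<Longrightarrow> component_sum f x + h x \<le> component_sum f z + h z"
  shows "0 \<le> rabier f \<Omega> x" "rabier f \<Omega> x \<le> norm (H x)"
proof -
  have e: "((\<lambda>x. 0::real) has_derivative (\<lambda>d. (0::'a) \<bullet> d)) (at z)" for z :: 'a by simp
  have x': "x \<in> \<Omega>" "f x \<le> ybar" using x by (simp_all add: section_domain_def)
  have min': "(\<Sum>i\<in>UNIV. f x $ i) + h x \<le> (\<Sum>i\<in>UNIV. f z $ i) + h z"
    if "z \<in> \<Omega>" "f z \<le> ybar" "(0::real) = 0" for z
    using min[of z] that by (simp add: section_domain_def component_sum_def)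
  obtain v l \<mu> \<alpha> w where v: "\<And>i. v i \<in> symmetric_subdiff (\<lambda>x. f x $ i) x"
    and l: "l \<in> nonneg_orthant" "(\<Sum>i\<in>UNIV. l $ i) + \<bar>\<mu>\<bar> = 1" and \<alpha>: "0 \<le> \<alpha>" "\<alpha> \<le> 1"
    and w: "w \<in> limiting_normal_cone x \<Omega>"
    and eq: "(\<Sum>i\<in>UNIV. l $ i *\<^sub>R v i) + \<mu> *\<^sub>R 0 + \<alpha> *\<^sub>R H x + w = 0"
    and \<mu>: "(\<forall>x::'a. (0::real) = 0) \<longrightarrow> \<mu> = 0"
    using multiplier_rule[OF f cl x' refl h H e continuous_const min'] by blast
  have sum1: "(\<Sum>i\<in>UNIV. l $ i) = 1" using l(2) \<mu> by simp
  have "(\<Sum>i\<in>UNIV. l $ i *\<^sub>R v i) + w = - (\<alpha> *\<^sub>R H x)"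
    using eq by (simp add: eq_neg_iff_add_eq_0 add_ac)
  then have "norm ((\<Sum>i\<in>UNIV. l $ i *\<^sub>R v i) + w) \<le> norm (H x)"
    using \<alpha> by (simp add: mult_left_le_one_le)
  with rabier_nonneg_le[of v, OF v w l(1) sum1]
  show "0 \<le> rabier f \<Omega> x" "rabier f \<Omega> x \<le> norm (H x)" by auto
qed

lemma Gamma_set_minimizer_on_sphere:
  fixes f :: "'a::euclidean_space \<Rightarrow> real ^ 'm"
  assumes f: "locally_lipschitz f" and cl: "closed \<Omega>" and x: "x \<in> section_domain f \<Omega> ybar"
    and min: "\<And>z. z \<in> section_domain f \<Omega> ybar \<Longrightarrow> norm z = norm x \<Longrightarrow> component_sum f x \<le> component_sum f z"
  shows "x \<in> Gamma_set f \<Omega>"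
proof -
  \<comment> \<open>The sphere through \<open>x\<close> as a smooth equation. The factor 1/2 makes
    the gradient at \<open>z\<close> equal to \<open>z\<close>, which produces the term
    \<open>\<mu> x\<close> of \<open>Gamma_set\<close>.\<close>
  define e :: "'a \<Rightarrow> real" where "e = (\<lambda>z. (z \<bullet> z - x \<bullet> x) / 2)"
  have e: "(e has_derivative (\<lambda>d. z \<bullet> d)) (at z)" for z
    unfolding e_def by (auto intro!: derivative_eq_intros simp: inner_commute)
  have h: "((\<lambda>x. 0::real) has_derivative (\<lambda>d. (0::'a) \<bullet> d)) (at z)" for z :: 'a by simp
  have ex: "e x = 0" and e0: "e z = 0 \<Longrightarrow> norm z = norm x" for z by (simp_all add: e_def norm_eq)
  have x': "x \<in> \<Omega>" "f x \<le> ybar" using x by (simp_all add: section_domain_def)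
  have min': "(\<Sum>i\<in>UNIV. f x $ i) + 0 \<le> (\<Sum>i\<in>UNIV. f z $ i) + 0"
    if "z \<in> \<Omega>" "f z \<le> ybar" "e z = 0" for z
    using min[of z] that e0 by (simp add: section_domain_def component_sum_def)
  show ?thesis
  proof (rule multiplier_rule[where H = "\<lambda>_. 0" and E = "\<lambda>z. z",
        OF f cl x' ex h continuous_const e continuous_ident min'])
    fix v :: "'m \<Rightarrow> 'a" and l :: "real ^ 'm" and \<mu> \<alpha> :: real and w :: 'a
    assume v: "\<And>i. v i \<in> symmetric_subdiff (\<lambda>x. f x $ i) x"
      and l: "l \<in> nonneg_orthant" "(\<Sum>i\<in>UNIV. l $ i) + \<bar>\<mu>\<bar> = 1"
      and w: "w \<in> limiting_normal_cone x \<Omega>"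
      and "(\<Sum>i\<in>UNIV. l $ i *\<^sub>R v i) + \<mu> *\<^sub>R x + \<alpha> *\<^sub>R 0 + w = 0"
    then have "0 = (\<Sum>i\<in>UNIV. l $ i *\<^sub>R v i) + \<mu> *\<^sub>R x + w" by simp
    with v l w x'(1) show "x \<in> Gamma_set f \<Omega>"
      unfolding Gamma_set_def by blast
  qed
qed

section \<open>Consequences of efficiency and comparison of the asymptotic sets\<close>

text \<open>On the section at \<open>f x\<close> the map \<open>f\<close> is constant by efficiency,
  so \<open>x\<close> minimizes the sum with perturbation 0, and the Rabier value is squeezed to
  0.\<close>

lemma K_zero_if_pareto_efficient:
  fixes f :: "'a::euclidean_space \<Rightarrow> real ^ 'm"
  assumes f: "locally_lipschitz f" and cl: "closed \<Omega>" and p: "pareto_efficient f \<Omega> x"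
  shows "f x \<in> K_zero f \<Omega> (f x)"
proof -
  have x: "x \<in> section_domain f \<Omega> (f x)"
    using p by (simp add: pareto_efficient_def section_domain_def)
  have "component_sum f x + 0 \<le> component_sum f z + 0" if "z \<in> section_domain f \<Omega> (f x)" for z
    using p that by (auto simp: pareto_efficient_def section_domain_def component_sum_def)
  from rabier_at_perturbed_minimizer[OF f cl x _ _ this, of "\<lambda>_. 0"]
  have "rabier f \<Omega> x = 0" by simp
  with x show ?thesis by (auto simp: K_zero_def section_domain_def)
qed

lemma bounded_section_if_pareto_efficient:
  assumes "pareto_efficient f \<Omega> x"
  shows "bounded_section (f ` \<Omega>) (f x)"
  unfolding bounded_section_def
proof
  show "lower_section (f ` \<Omega>) (f x) \<subseteq> (\<lambda>z. f x + z) ` nonneg_orthant"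
  proof
    fix y
    assume "y \<in> lower_section (f ` \<Omega>) (f x)"
    then obtain z d where z: "y = f z" "z \<in> \<Omega>" and d: "y = f x - d" "\<forall>i. 0 \<le> d $ i"
      unfolding lower_section_def nonneg_orthant_def by blast
    have "f z \<le> f x" using d z(1) by (simp add: less_eq_vec_def)
    with z have "y = f x"
      using assms by (auto simp: pareto_efficient_def)
    then show "y \<in> (\<lambda>z. f x + z) ` nonneg_orthant"
      by (auto simp: nonneg_orthant_def intro!: image_eqI[of _ _ 0])
  qed
qed

text \<open>Efficiency makes the values along the sequence constant, so the only possible limit is
  \<open>f x\<close>.\<close>

lemma asymptotic_subset_K_zero:
  fixes f :: "'a::euclidean_space \<Rightarrow> real ^ 'm"
  assumes f: "locally_lipschitz f" and cl: "closed \<Omega>" and p: "pareto_efficient f \<Omega> x"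
    and xs: "\<And>k. xs k \<in> \<Omega>" "\<And>k. f (xs k) \<le> f x" and lim: "(\<lambda>k. f (xs k)) \<longlonglongrightarrow> y"
  shows "y \<in> K_zero f \<Omega> (f x)"
proof -
  have "f (xs k) = f x" for k
    using p xs[of k] by (auto simp: pareto_efficient_def)
  with lim have "y = f x" by (simp add: LIMSEQ_const_iff)
  with K_zero_if_pareto_efficient[OF f cl p] show ?thesis by simp
qed

text \<open>Dividing by norms that tend to infinity preserves convergence to 0. Hence the inclusion
  for \<open>Ktilde_inf\<close> implies the one for \<open>K_inf\<close>.\<close>

lemma K_inf_subset_Ktilde_inf: "K_inf f \<Omega> ybar \<subseteq> Ktilde_inf f \<Omega> ybar"
proof
  fix y
  assume "y \<in> K_inf f \<Omega> ybar"
  then obtain xs where xs: "\<forall>k. xs k \<in> \<Omega>" "\<forall>k. f (xs k) \<le> ybar"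
    "filterlim (\<lambda>k. norm (xs k)) at_top sequentially" "(\<lambda>k. f (xs k)) \<longlonglongrightarrow> y"
    and lim: "(\<lambda>k. norm (xs k) * rabier f \<Omega> (xs k)) \<longlonglongrightarrow> 0"
    unfolding K_inf_def by blast
  have "(\<lambda>k. inverse (norm (xs k))) \<longlonglongrightarrow> 0"
    using xs(3) by (rule tendsto_inverse_0_at_top)
  from tendsto_mult[OF this lim]
  have "(\<lambda>k. inverse (norm (xs k)) * (norm (xs k) * rabier f \<Omega> (xs k))) \<longlonglongrightarrow> 0" by simp
  moreover have "\<forall>\<^sub>F k in sequentially. inverse (norm (xs k)) * (norm (xs k) * rabier f \<Omega> (xs k))
      = rabier f \<Omega> (xs k)"
    using xs(3)[unfolded filterlim_at_top_dense, rule_format, of 0] by eventually_elim simp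
  ultimately have "(\<lambda>k. rabier f \<Omega> (xs k)) \<longlonglongrightarrow> 0" by (rule Lim_transform_eventually)
  with xs show "y \<in> Ktilde_inf f \<Omega> ybar" unfolding Ktilde_inf_def by blast
qed

section \<open>Existence of efficient points from a bounded section\<close>

locale bounded_section_problem =
  fixes f :: "'a::euclidean_space \<Rightarrow> real ^ 'm" and \<Omega> :: "'a set" and ybar :: "real ^ 'm"
  assumes f: "locally_lipschitz f" and cl: "closed \<Omega>"
    and ybar: "ybar \<in> f ` \<Omega>" and bd: "bounded_section (f ` \<Omega>) ybar"
begin

abbreviation S :: "'a set" where "S \<equiv> section_domain f \<Omega> ybar"

lemma continuous_on_f: "continuous_on T f"
  using locally_lipschitz_isCont[OF f] by (simp add: continuous_at_imp_continuous_on)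

lemma continuous_on_component_sum: "continuous_on T (component_sum f)"
  unfolding component_sum_def by (intro continuous_intros continuous_on_f)

lemma closed_S: "closed S"
proof -
  have "S = \<Omega> \<inter> (\<Inter>i. {x. f x $ i \<le> ybar $ i})"
    by (auto simp: section_domain_def less_eq_vec_def)
  then show ?thesis
    by (simp only:) (intro cl closed_Int closed_INT ballI closed_Collect_le continuous_intros continuous_on_f)
qed

lemma S_nonempty: "S \<noteq> {}"
  using ybar by (auto simp: section_domain_def)

text \<open>The bounded section supplies the lower bound and \<open>ybar\<close> the upper one; the
  resulting order interval is compact, so values along any sequence in \<open>S\<close>
  cluster.\<close>

lemma f_bounds: "\<exists>a. \<forall>x\<in>S. f x \<in> {a..ybar}"
proof -
  obtain a where a: "lower_section (f ` \<Omega>) ybar \<subseteq> (\<lambda>z. a + z) ` nonneg_orthant"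
    using bd unfolding bounded_section_def by blast
  have "f x \<in> {a..ybar}" if x: "x \<in> S" for x
  proof -
    have "f x \<in> lower_section (f ` \<Omega>) ybar"
      using x unfolding lower_section_def nonneg_orthant_def section_domain_def
      by (auto simp: less_eq_vec_def intro!: image_eqI[of _ _ "ybar - f x"])
    with a obtain z where "f x = a + z" "\<forall>i. 0 \<le> z $ i" by (auto simp: nonneg_orthant_def)
    with x show ?thesis by (auto simp: section_domain_def less_eq_vec_def)
  qed
  then show ?thesis by blast
qed

lemma bdd_below_component_sum: "bdd_below (component_sum f ` S)"
proof -
  obtain a where a: "\<And>x. x \<in> S \<Longrightarrow> f x \<in> {a..ybar}" using f_bounds by blast
  have "(\<Sum>i\<in>UNIV. a $ i) \<le> component_sum f x" if "x \<in> S" for x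
    unfolding component_sum_def using a[OF that] by (intro sum_mono) (simp add: less_eq_vec_def)
  then show ?thesis by (rule bdd_belowI2)
qed

definition inf_val where "inf_val = Inf (component_sum f ` S)"

lemma inf_val_le: "x \<in> S \<Longrightarrow> inf_val \<le> component_sum f x"
  unfolding inf_val_def using bdd_below_component_sum by (intro cInf_lower) auto

lemma below_inf_val:
  assumes "inf_val < t"
  shows "\<exists>z\<in>S. component_sum f z < t"
  using cInf_lessD[of "component_sum f ` S" t] S_nonempty assms unfolding inf_val_def by blast

text \<open>Otherwise infinitely many terms stay in one ball and cluster at a point of the closed
  set \<open>S\<close>; by continuity it attains \<open>inf_val\<close> and is efficient.\<close>

lemma norm_at_top_if_minimizing:
  assumes xs: "\<And>k. xs k \<in> S" and lim: "(\<lambda>k. component_sum f (xs k)) \<longlonglongrightarrow> inf_val"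
    and none: "\<nexists>x. pareto_efficient f \<Omega> x"
  shows "filterlim (\<lambda>k. norm (xs k)) at_top sequentially"
proof (rule ccontr)
  assume "\<not> ?thesis"
  then obtain M where M: "\<not> (\<forall>\<^sub>F k in sequentially. M \<le> norm (xs k))"
    unfolding filterlim_at_top by blast
  then have "\<exists>\<^sub>F k in sequentially. norm (xs k) \<le> M"
    unfolding frequently_def by (rule contrapos_nn) (auto elim: eventually_mono)
  then have "infinite {k. norm (xs k) \<le> M}"
    by (simp only: frequently_cofinite[symmetric] cofinite_eq_sequentially)
  then obtain r :: "nat \<Rightarrow> nat" where r: "strict_mono r" "\<And>k. norm (xs (r k)) \<le> M"
    using infinite_enumerate by blast
  have "compact (S \<inter> cball 0 M)" by (intro closed_Int_compact closed_S compact_cball)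
  moreover have "xs (r k) \<in> S \<inter> cball 0 M" for k using xs r(2) by simp
  ultimately obtain x s where x: "x \<in> S \<inter> cball 0 M" and s: "strict_mono s"
    and xlim: "((\<lambda>k. xs (r k)) \<circ> s) \<longlonglongrightarrow> x"
    unfolding compact_def by meson
  have "(\<lambda>k. component_sum f (xs (r (s k)))) \<longlonglongrightarrow> component_sum f x"
    using continuous_on_tendsto_compose[OF continuous_on_component_sum[of UNIV] xlim] by (simp add: o_def)
  moreover have "(\<lambda>k. component_sum f (xs (r (s k)))) \<longlonglongrightarrow> inf_val"
    using LIMSEQ_subseq_LIMSEQ[OF lim strict_mono_o[OF r(1) s]] by (simp add: o_def)
  ultimately have "component_sum f x = inf_val" by (rule LIMSEQ_unique)
  with x inf_val_le have "pareto_efficient f \<Omega> x"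
    by (intro pareto_efficient_if_minimizes_component_sum[of x f \<Omega> ybar]) auto
  with none show False by blast
qed

text \<open>A cluster value \<open>y\<close> has component sum \<open>inf_val\<close>. If it were
  \<open>f x\<close> with \<open>x\<close> in \<open>S\<close>, then \<open>x\<close> would attain
  the infimum and be efficient.\<close>

lemma no_asymptotic_value_in_K_zero:
  assumes none: "\<nexists>x. pareto_efficient f \<Omega> x"
    and xs: "\<And>k. xs k \<in> S" and lim: "(\<lambda>k. component_sum f (xs k)) \<longlonglongrightarrow> inf_val"
  obtains r y where "strict_mono r" "(\<lambda>k. f (xs (r k))) \<longlonglongrightarrow> y" "y \<notin> K_zero f \<Omega> ybar"
proof -
  obtain a where a: "\<And>x. x \<in> S \<Longrightarrow> f x \<in> {a..ybar}" using f_bounds by blast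
  have "compact {a..ybar}" by (simp add: interval_cbox[symmetric])
  then obtain y r where r: "strict_mono r" and ylim: "((\<lambda>k. f (xs k)) \<circ> r) \<longlonglongrightarrow> y"
    using a[OF xs] unfolding compact_def by meson
  have "(\<lambda>k. component_sum f (xs (r k))) \<longlonglongrightarrow> (\<Sum>i\<in>UNIV. y $ i)"
    unfolding component_sum_def using ylim by (intro tendsto_intros) (simp add: o_def)
  moreover have "(\<lambda>k. component_sum f (xs (r k))) \<longlonglongrightarrow> inf_val"
    using LIMSEQ_subseq_LIMSEQ[OF lim r] by (simp add: o_def)
  ultimately have yc: "(\<Sum>i\<in>UNIV. y $ i) = inf_val" by (rule LIMSEQ_unique)
  have "y \<notin> K_zero f \<Omega> ybar"
  proof
    assume "y \<in> K_zero f \<Omega> ybar"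
    then obtain x where x: "x \<in> S" "y = f x" by (auto simp: K_zero_def section_domain_def)
    with yc have "component_sum f x = inf_val" by (simp add: component_sum_def)
    with x inf_val_le have "pareto_efficient f \<Omega> x"
    by (intro pareto_efficient_if_minimizes_component_sum[of x f \<Omega> ybar]) auto
  with none show False by blast
  qed
  with that r ylim show thesis by (simp add: o_def)
qed

lemma perturbed_minimizer:
  assumes "\<epsilon> > 0"
  obtains x where "x \<in> S"
    "\<And>z. z \<in> S \<Longrightarrow> component_sum f x + \<epsilon> * ln (1 + x \<bullet> x) \<le> component_sum f z + \<epsilon> * ln (1 + z \<bullet> z)"
proof -
  let ?g = "\<lambda>x. component_sum f x + \<epsilon> * ln (1 + x \<bullet> x)"
  obtain x0 where x0: "x0 \<in> S" using S_nonempty by blast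
  \<comment> \<open>If \<open>x\<close> is no worse than \<open>x0\<close>, then
    \<open>\<epsilon> * ln (1 + x \<bullet> x)\<close> is at most \<open>?g x0 - inf_val\<close>, so
    \<open>1 + x \<bullet> x \<le> R\<close>, and \<open>2 * norm x \<le> 1 + x \<bullet> x\<close>
    puts \<open>x\<close> in the ball.\<close>
  define R where "R = exp ((?g x0 - inf_val) / \<epsilon>)"
  have pos: "0 < 1 + x \<bullet> x" for x :: 'a by (simp add: add_pos_nonneg)
  have inR: "x \<in> cball 0 R" if "x \<in> S" "?g x \<le> ?g x0" for x
  proof -
    have "\<epsilon> * ln (1 + x \<bullet> x) \<le> ?g x0 - inf_val" using that inf_val_le[of x] by linarith
    then have "ln (1 + x \<bullet> x) \<le> (?g x0 - inf_val) / \<epsilon>" using assms by (simp add: field_simps)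
    then have "exp (ln (1 + x \<bullet> x)) \<le> R" unfolding R_def by (simp only: exp_le_cancel_iff)
    then have "1 + x \<bullet> x \<le> R" using pos[of x] by (simp only: exp_ln)
    moreover have "2 * norm x \<le> 1 + x \<bullet> x"
      using zero_le_power2[of "norm x - 1"] by (simp add: power2_diff power2_norm_eq_inner)
    ultimately show ?thesis using norm_ge_zero[of x] unfolding mem_cball_0 by linarith
  qed
  have "compact (S \<inter> cball 0 R)" by (intro closed_Int_compact closed_S compact_cball)
  moreover have "x0 \<in> S \<inter> cball 0 R" using x0 inR by simp
  moreover have "continuous_on (S \<inter> cball 0 R) ?g"
    using pos by (intro continuous_intros continuous_on_component_sum) (auto simp: less_imp_neq[symmetric])
  ultimately obtain x where x: "x \<in> S" "\<And>z. z \<in> S \<inter> cball 0 R \<Longrightarrow> ?g x \<le> ?g z"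
    using continuous_attains_inf[of "S \<inter> cball 0 R" ?g] by blast
  have "?g x \<le> ?g z" if "z \<in> S" for z
  proof (cases "?g z \<le> ?g x0")
    case True
    with inR that x(2) show ?thesis by blast
  next
    case False
    moreover have "?g x \<le> ?g x0" using x(2) inR x0 by blast
    ultimately show ?thesis by linarith
  qed
  with that x(1) show thesis by blast
qed

text \<open>The logarithm grows fast enough for minimizers to exist and slowly enough that the norm
  of its gradient times \<open>norm x\<close> stays below 2; this is the decay that
  \<open>K_inf\<close> asks for.\<close>

lemma pareto_efficient_if_K_inf:
  assumes sub: "K_inf f \<Omega> ybar \<subseteq> K_zero f \<Omega> ybar"
  shows "\<exists>x. pareto_efficient f \<Omega> x"
proof (rule ccontr)
  assume none: "\<nexists>x. pareto_efficient f \<Omega> x"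
  define \<epsilon> where "\<epsilon> = (\<lambda>k. inverse (real (Suc k)))"
  have \<epsilon>: "\<epsilon> k > 0" for k by (simp add: \<epsilon>_def)
  have \<epsilon>0: "\<epsilon> \<longlonglongrightarrow> 0" unfolding \<epsilon>_def by (rule LIMSEQ_inverse_real_of_nat)
  have "\<exists>x\<in>S. \<forall>z\<in>S. component_sum f x + \<epsilon> k * ln (1 + x \<bullet> x) \<le> component_sum f z + \<epsilon> k * ln (1 + z \<bullet> z)" for k
    using perturbed_minimizer[OF \<epsilon>] by metis
  then obtain xs where xs: "\<And>k. xs k \<in> S"
    and xmin: "\<And>k z. z \<in> S \<Longrightarrow> component_sum f (xs k) + \<epsilon> k * ln (1 + xs k \<bullet> xs k)
      \<le> component_sum f z + \<epsilon> k * ln (1 + z \<bullet> z)"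
    by metis
  have lim: "(\<lambda>k. component_sum f (xs k)) \<longlonglongrightarrow> inf_val"
  proof (rule order_tendstoI)
    fix t
    assume "t < inf_val"
    then show "\<forall>\<^sub>F k in sequentially. t < component_sum f (xs k)"
      using inf_val_le[OF xs] by (intro always_eventually) (auto intro: less_le_trans)
  next
    fix t
    assume "inf_val < t"
    then obtain z where z: "z \<in> S" "component_sum f z < t" using below_inf_val by blast
    \<comment> \<open>For a fixed competitor \<open>z\<close> the perturbation disappears as
      \<open>\<epsilon> k\<close> tends to 0, so the perturbed minimizers form a minimizing sequence
      for the sum itself.\<close>
    have "(\<lambda>k. component_sum f z + \<epsilon> k * ln (1 + z \<bullet> z)) \<longlonglongrightarrow> component_sum f z + 0 * ln (1 + z \<bullet> z)"
      by (intro tendsto_intros \<epsilon>0)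
    then have "\<forall>\<^sub>F k in sequentially. component_sum f z + \<epsilon> k * ln (1 + z \<bullet> z) < t"
      using z(2) by (intro order_tendstoD(2)) auto
    then show "\<forall>\<^sub>F k in sequentially. component_sum f (xs k) < t"
    proof eventually_elim
      case (elim k)
      have "0 \<le> \<epsilon> k * ln (1 + xs k \<bullet> xs k)" using \<epsilon>[of k] by simp
      with xmin[OF z(1), of k] elim show ?case by linarith
    qed
  qed
  have rab: "0 \<le> rabier f \<Omega> (xs k) \<and> norm (xs k) * rabier f \<Omega> (xs k) \<le> 2 * \<epsilon> k" for k
  proof -
    define H :: "'a \<Rightarrow> 'a" where "H = (\<lambda>x. (2 * \<epsilon> k / (1 + x \<bullet> x)) *\<^sub>R x)"
    have pos: "0 < 1 + x \<bullet> x" for x :: 'a by (simp add: add_pos_nonneg)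
    have der: "((\<lambda>x. \<epsilon> k * ln (1 + x \<bullet> x)) has_derivative (\<lambda>d. H x \<bullet> d)) (at x)" for x
      unfolding H_def using pos[of x]
      by (auto intro!: derivative_eq_intros simp: fun_eq_iff inner_commute field_simps)
    have "isCont H (xs k)"
      unfolding H_def using pos[of "xs k"] by (intro continuous_intros) auto
    note r = rabier_at_perturbed_minimizer[OF f cl xs der this xmin]
    have "norm (xs k) * norm (H (xs k)) = 2 * \<epsilon> k * (xs k \<bullet> xs k / (1 + xs k \<bullet> xs k))"
      using pos[of "xs k"] \<epsilon>[of k]
      by (simp add: H_def power2_norm_eq_inner[symmetric] power2_eq_square)
    also have "\<dots> \<le> 2 * \<epsilon> k * 1"
      using pos[of "xs k"] \<epsilon>[of k] by (intro mult_left_mono) auto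
    finally show ?thesis
      using r mult_left_mono[OF r(2) norm_ge_zero[of "xs k"]] by simp
  qed
  have rlim: "(\<lambda>k. norm (xs k) * rabier f \<Omega> (xs k)) \<longlonglongrightarrow> 0"
  proof (rule tendsto_sandwich[of "\<lambda>_. 0" _ _ "\<lambda>k. 2 * \<epsilon> k"])
    show "(\<lambda>k. 2 * \<epsilon> k) \<longlonglongrightarrow> 0" using tendsto_mult_right_zero[OF \<epsilon>0] by simp
  qed (use rab in auto)
  obtain r y where r: "strict_mono r" and y: "(\<lambda>k. f (xs (r k))) \<longlonglongrightarrow> y" "y \<notin> K_zero f \<Omega> ybar"
    using no_asymptotic_value_in_K_zero[OF none xs lim] by blast
  have "y \<in> K_inf f \<Omega> ybar"
    unfolding K_inf_def
  proof (intro CollectI exI[of _ "\<lambda>k. xs (r k)"] conjI allI y)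
    show "filterlim (\<lambda>k. norm (xs (r k))) at_top sequentially"
      using filterlim_compose[OF norm_at_top_if_minimizing[OF xs lim none] filterlim_subseq[OF r]] .
    show "(\<lambda>k. norm (xs (r k)) * rabier f \<Omega> (xs (r k))) \<longlonglongrightarrow> 0"
      using LIMSEQ_subseq_LIMSEQ[OF rlim r] by (simp add: o_def)
  qed (use xs in \<open>auto simp: section_domain_def\<close>)
  with sub y show False by blast
qed

text \<open>Moving each term of a minimizing sequence to a best point on its own sphere does not
  increase the sum, so the new sequence is still minimizing and its norms tend to infinity, and it
  now lies in \<open>Gamma_set\<close>.\<close>

lemma pareto_efficient_if_T_inf:
  assumes sub: "T_inf f \<Omega> ybar \<subseteq> K_zero f \<Omega> ybar"
  shows "\<exists>x. pareto_efficient f \<Omega> x"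
proof (rule ccontr)
  assume none: "\<nexists>x. pareto_efficient f \<Omega> x"
  have "\<exists>z\<in>S. component_sum f z < inf_val + inverse (real (Suc k))" for k
    by (rule below_inf_val) simp
  then obtain zs where zs: "\<And>k. zs k \<in> S" "\<And>k. component_sum f (zs k) < inf_val + inverse (real (Suc k))"
    by metis
  have "\<exists>x\<in>S. norm x = norm (zs k) \<and> (\<forall>z\<in>S. norm z = norm (zs k) \<longrightarrow> component_sum f x \<le> component_sum f z)" for k
  proof -
    have "compact (S \<inter> sphere 0 (norm (zs k)))"
      by (intro closed_Int_compact closed_S compact_sphere)
    moreover have "zs k \<in> S \<inter> sphere 0 (norm (zs k))" using zs by simp
    ultimately obtain x where "x \<in> S \<inter> sphere 0 (norm (zs k))"
      "\<forall>z\<in>S \<inter> sphere 0 (norm (zs k)). component_sum f x \<le> component_sum f z"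
      using continuous_attains_inf[OF _ _ continuous_on_component_sum] by blast
    then show ?thesis by (intro bexI[of _ x]) auto
  qed
  then obtain xs where xs: "\<And>k. xs k \<in> S" "\<And>k. norm (xs k) = norm (zs k)"
    and xmin: "\<And>k z. z \<in> S \<Longrightarrow> norm z = norm (zs k) \<Longrightarrow> component_sum f (xs k) \<le> component_sum f z"
    by metis
  have lim: "(\<lambda>k. component_sum f (xs k)) \<longlonglongrightarrow> inf_val"
  proof (rule tendsto_sandwich[of "\<lambda>_. inf_val" _ _ "\<lambda>k. inf_val + inverse (real (Suc k))"])
    show "(\<lambda>k. inf_val + inverse (real (Suc k))) \<longlonglongrightarrow> inf_val"
      using tendsto_add[OF tendsto_const LIMSEQ_inverse_real_of_nat, of inf_val] by simp
    have "component_sum f (xs k) \<le> inf_val + inverse (real (Suc k))" for k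
      using xmin[OF zs(1) refl, of k] zs(2)[of k] by linarith
    then show "\<forall>\<^sub>F k in sequentially. component_sum f (xs k) \<le> inf_val + inverse (real (Suc k))" by simp
  qed (use inf_val_le[OF xs(1)] in auto)
  have \<Gamma>: "xs k \<in> Gamma_set f \<Omega>" for k
    by (rule Gamma_set_minimizer_on_sphere[OF f cl xs(1)]) (use xmin xs(2) in auto)
  obtain r y where r: "strict_mono r" and y: "(\<lambda>k. f (xs (r k))) \<longlonglongrightarrow> y" "y \<notin> K_zero f \<Omega> ybar"
    using no_asymptotic_value_in_K_zero[OF none xs(1) lim] by blast
  have "y \<in> T_inf f \<Omega> ybar"
    unfolding T_inf_def
  proof (intro CollectI exI[of _ "\<lambda>k. xs (r k)"] conjI allI y \<Gamma>)
    show "filterlim (\<lambda>k. norm (xs (r k))) at_top sequentially"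
      using filterlim_compose[OF norm_at_top_if_minimizing[OF xs(1) lim none] filterlim_subseq[OF r]] .
  qed (use xs in \<open>auto simp: section_domain_def\<close>)
  with sub y show False by blast
qed

end

theorem theorem4p1:
  fixes f :: "real ^ 'n \<Rightarrow> real ^ 'm" and \<Omega> :: "(real ^ 'n) set"
  assumes "locally_lipschitz f" and "closed \<Omega>" and "\<Omega> \<noteq> {}"
  shows "((\<exists>xbar. pareto_efficient f \<Omega> xbar) \<longleftrightarrow>
          (\<exists>ybar \<in> f ` \<Omega>. bounded_section (f ` \<Omega>) ybar \<and> Ktilde_inf f \<Omega> ybar \<subseteq> K_zero f \<Omega> ybar)) \<and>
         ((\<exists>xbar. pareto_efficient f \<Omega> xbar) \<longleftrightarrow>
          (\<exists>ybar \<in> f ` \<Omega>. bounded_section (f ` \<Omega>) ybar \<and> K_inf f \<Omega> ybar \<subseteq> K_zero f \<Omega> ybar)) \<and>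
         ((\<exists>xbar. pareto_efficient f \<Omega> xbar) \<longleftrightarrow>
          (\<exists>ybar \<in> f ` \<Omega>. bounded_section (f ` \<Omega>) ybar \<and> T_inf f \<Omega> ybar \<subseteq> K_zero f \<Omega> ybar))"
proof -
  \<comment> \<open>The single choice \<open>ybar = f x\<close> serves all three conditions.\<close>
  have necessary: "\<exists>ybar \<in> f ` \<Omega>. bounded_section (f ` \<Omega>) ybar \<and> Ktilde_inf f \<Omega> ybar \<subseteq> K_zero f \<Omega> ybar
      \<and> K_inf f \<Omega> ybar \<subseteq> K_zero f \<Omega> ybar \<and> T_inf f \<Omega> ybar \<subseteq> K_zero f \<Omega> ybar"
    if p: "pareto_efficient f \<Omega> x" for x
  proof (intro bexI[of _ "f x"] conjI)
    show "f x \<in> f ` \<Omega>" using p by (simp add: pareto_efficient_def)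
    show "bounded_section (f ` \<Omega>) (f x)" using p by (rule bounded_section_if_pareto_efficient)
    show Kt: "Ktilde_inf f \<Omega> (f x) \<subseteq> K_zero f \<Omega> (f x)"
      using asymptotic_subset_K_zero[OF assms(1,2) p] by (auto simp: Ktilde_inf_def)
    show "K_inf f \<Omega> (f x) \<subseteq> K_zero f \<Omega> (f x)"
      using Kt K_inf_subset_Ktilde_inf by blast
    show "T_inf f \<Omega> (f x) \<subseteq> K_zero f \<Omega> (f x)"
      using asymptotic_subset_K_zero[OF assms(1,2) p] by (fastforce simp: T_inf_def Gamma_set_def)
  qed
  \<comment> \<open>The \<open>Ktilde_inf\<close> case reduces to the \<open>K_inf\<close> case
    through the inclusion between the two sets.\<close>
  have sufficient: "\<exists>x. pareto_efficient f \<Omega> x"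
    if "ybar \<in> f ` \<Omega>" "bounded_section (f ` \<Omega>) ybar"
      and "Ktilde_inf f \<Omega> ybar \<subseteq> K_zero f \<Omega> ybar \<or> K_inf f \<Omega> ybar \<subseteq> K_zero f \<Omega> ybar \<or>
        T_inf f \<Omega> ybar \<subseteq> K_zero f \<Omega> ybar" for ybar
  proof -
    interpret bounded_section_problem f \<Omega> ybar
      using assms that by unfold_locales
    show ?thesis
      using that(3) pareto_efficient_if_K_inf pareto_efficient_if_T_inf
        K_inf_subset_Ktilde_inf[of f \<Omega> ybar] by blast
  qed
  from necessary sufficient show ?thesis by meson
qed

end
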